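(* Let $\Sigma$ be a finite alphabet, let $n\ge 2|\Sigma|-1$, and let $(p(v))_{v\in\Sigma^n}$ be an (unconstrained) probability distribution on $\Sigma^n$, i.e. a family of non-negative real numbers (whose sum need not be $1$). For strings $v\in\Sigma^*$ with $|v|<n$ put $p(v):=\sum_{w\in\Sigma^{n-|v|}}p(vw)$. Then $(p(v))_{v\in\Sigma^n}$ lies in the image of $\mathbf{f}_{n,|\Sigma|}$ if and only if $$\det\begin{bmatrix}p(vau)&p(wau)\\ p(vau')&p(wau')\end{bmatrix}=0$$ for all $u,u',v,w\in\Sigma^*$ and $a\in\Sigma$ such that $|vau|,|vau'|,|wau|,|wau'|\le n$.
   Context: $\Sigma^*$ is the set of all finite strings over $\Sigma$, including the empty string; $|v|$ is the length of $v$ and concatenation is written by juxtaposition. Here, with $l=|\Sigma|$, $\mathbf{f}_{n,l}$ is the polynomial map of the Markov model $$\mathbf{f}_{n,l}:\mathbb{C}^{l+l(l-1)}\to\mathbb{C}^{|\Sigma|^n},\qquad(\pi,M)\mapsto\Big(\pi(a_1)\prod_{i=2}^nM_{a_{i-1}a_i}\Big)_{v=a_1\dots a_n\in\Sigma^n},$$ where $\pi\in\mathbb{C}^{\Sigma}$ is an arbitrary vector (entries not required to sum to $1$) and $M\in\mathbb{C}^{\Sigma\times\Sigma}$ is a matrix each of whose rows sums to $1$. *)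

theory Defs
  imports "HOL-Analysis.Analysis"
begin

text \<open>The alphabet is a type of class \<open>finite\<close>; strings are lists over it.\<close>

definition words :: "nat \<Rightarrow> 'a list set" where
  "words n = {w. length w = n}"

text \<open>The coordinates of a matrix with unit row sums are \<open>l (l - 1)\<close> free entries; here the
  parameter space is the affine subspace cut out by the row sum condition.
  The vector \<open>\<pi>\<close> is unrestricted.\<close>

definition markov_params :: "((complex ^ 'a::finite) \<times> (complex ^ 'a ^ 'a)) set" where
  "markov_params = {(\<pi>, M). \<forall>a. (\<Sum>b\<in>UNIV. M $ a $ b) = 1}"

text \<open>A point of \<open>\<complex>\<close> to the power \<open>words n\<close> is a function that is \<open>undefined\<close> off
  \<open>words n\<close>. List positions start at 0, and \<open>n \<ge> 1\<close> is intended.\<close>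

definition markov_map ::
  "nat \<Rightarrow> (complex ^ 'a::finite) \<times> (complex ^ 'a ^ 'a) \<Rightarrow> 'a list \<Rightarrow> complex" where
  "markov_map n = (\<lambda>(\<pi>, M). \<lambda>v\<in>words n.
     \<pi> $ (v ! 0) * (\<Prod>i = 1..<n. M $ (v ! (i - 1)) $ (v ! i)))"

text \<open>Extension of a family on \<open>words n\<close> to shorter strings; it agrees with \<open>p\<close> on \<open>words n\<close>
  and is only meaningful for \<open>length v \<le> n\<close>.\<close>

definition prefix_sum :: "nat \<Rightarrow> ('a::finite list \<Rightarrow> real) \<Rightarrow> 'a list \<Rightarrow> real" where
  "prefix_sum n p v = (\<Sum>w\<in>words (n - length v). p (v @ w))"

end

theory Submission
  imports Defs
begin

text \<open>Write \<open>P\<close> for the extension of \<open>p\<close> by prefix sums. If \<open>p\<close> comes from \<open>(\<pi>, M)\<close>, the row sum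
  condition gives \<open>P (v a u) = P (v a) G(a, u)\<close> with \<open>G(a, u)\<close> the product of the transition entries
  along \<open>a u\<close>, so all the determinants vanish. Conversely, the determinants with \<open>u\<close> empty and
  \<open>u' = b\<close> say that \<open>P (v a b) / P (v a)\<close> depends only on \<open>a\<close> and \<open>b\<close>; this ratio is \<open>M\<close>. If
  \<open>P (v a) = 0\<close>, nonnegativity forces \<open>P (v a b) = 0\<close>, so rows of \<open>M\<close> that are never determined
  can be any vectors of sum \<open>1\<close>.\<close>

lemma words_0 [simp]: "words 0 = {[]}"
  by (auto simp: words_def)

lemma sum_words_Suc:
  fixes f :: "'a::finite list \<Rightarrow> 'b::comm_monoid_add"
  shows "(\<Sum>w\<in>words (Suc k). f w) = (\<Sum>b\<in>UNIV. \<Sum>w\<in>words k. f (b # w))"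
proof -
  have "(\<Sum>b\<in>UNIV. \<Sum>w\<in>words k. f (b # w)) = (\<Sum>(b, w)\<in>UNIV \<times> words k. f (b # w))"
    by (rule sum.cartesian_product)
  also have "\<dots> = (\<Sum>w\<in>words (Suc k). f w)"
    by (rule sum.reindex_bij_witness[where j = "\<lambda>(b, w). b # w" and i = "\<lambda>w. (hd w, tl w)"])
      (auto simp: words_def length_Suc_conv)
  finally show ?thesis ..
qed

lemma prefix_sum_full: "length v = n \<Longrightarrow> prefix_sum n p v = p v"
  by (simp add: prefix_sum_def)

lemma prefix_sum_snoc:
  assumes "length v < n"
  shows "prefix_sum n p v = (\<Sum>b\<in>UNIV. prefix_sum n p (v @ [b]))"
proof -
  obtain k where "n - length v = Suc k" "n - Suc (length v) = k"
    using assms by (cases "n - length v") auto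
  then show ?thesis
    by (simp add: prefix_sum_def sum_words_Suc)
qed

lemma prefix_sum_nonneg:
  assumes "\<And>w. w \<in> words n \<Longrightarrow> p w \<ge> 0" and "length v \<le> n"
  shows "prefix_sum n p v \<ge> 0"
  unfolding prefix_sum_def using assms by (intro sum_nonneg) (auto simp: words_def)

text \<open>The transition product of \<open>markov_map\<close> along \<open>a # u\<close>, made
  recursive for induction on \<open>u\<close>. The value type stays generic since \<open>m\<close>
  is complex in the forward direction and real in the converse.\<close>

fun path_weight :: "('a \<Rightarrow> 'a \<Rightarrow> 'b::comm_semiring_1) \<Rightarrow> 'a \<Rightarrow> 'a list \<Rightarrow> 'b" where
  "path_weight m a [] = 1"
| "path_weight m a (b # u) = m a b * path_weight m b u"

text \<open>This is the Markov property: once \<open>a\<close> is reached, the remaining factor does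
  not depend on the earlier letters.\<close>

lemma path_weight_append:
  "path_weight m b (v @ a # u) = path_weight m b (v @ [a]) * path_weight m a u"
  by (induction v arbitrary: b) (simp_all add: mult.assoc)

lemma sum_path_weight:
  fixes m :: "'a::finite \<Rightarrow> 'a \<Rightarrow> 'b::comm_semiring_1"
  assumes "\<And>a. (\<Sum>b\<in>UNIV. m a b) = 1"
  shows "(\<Sum>w\<in>words k. path_weight m a w) = 1"
proof (induction k arbitrary: a)
  case (Suc k)
  then show ?case
    by (simp add: sum_words_Suc assms flip: sum_distrib_left)
qed simp

text \<open>From the last letter of \<open>a # u\<close> on, the continuations have total weight 1.
  Hence the product formula survives the passage to prefix sums of shorter words.\<close>

lemma sum_path_weight_append:
  fixes m :: "'a::finite \<Rightarrow> 'a \<Rightarrow> 'b::comm_semiring_1"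
  assumes "\<And>a. (\<Sum>b\<in>UNIV. m a b) = 1"
  shows "(\<Sum>w\<in>words k. path_weight m a (u @ w)) = path_weight m a u"
  by (induction u arbitrary: a) (simp_all add: sum_path_weight assms flip: sum_distrib_left)

lemma path_weight_of_real:
  "path_weight (\<lambda>a b. of_real (m a b)) a u = of_real (path_weight m a u)"
  by (induction u arbitrary: a) simp_all

lemma prod_steps_eq_path_weight:
  "(\<Prod>i = 1..<length (a # u). m ((a # u) ! (i - 1)) ((a # u) ! i)) = path_weight m a u"
proof (induction u arbitrary: a)
  case (Cons b u)
  have "(\<Prod>i = 1..<length (a # b # u). m ((a # b # u) ! (i - 1)) ((a # b # u) ! i))
      = (\<Prod>i = 0..<Suc (length u). m ((a # b # u) ! i) ((b # u) ! i))"
    using prod.shift_bounds_Suc_ivl[of "\<lambda>i. m ((a # b # u) ! (i - 1)) ((a # b # u) ! i)"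
        0 "Suc (length u)"]
    by simp
  also have "\<dots> = m a b * (\<Prod>i = 0..<length u. m ((b # u) ! i) (u ! i))"
    by (subst prod.atLeast0_lessThan_Suc_shift) simp
  also have "(\<Prod>i = 0..<length u. m ((b # u) ! i) (u ! i)) = path_weight m b u"
    using Cons.IH[of b]
      prod.shift_bounds_Suc_ivl[of "\<lambda>i. m ((b # u) ! (i - 1)) ((b # u) ! i)" 0 "length u"]
    by simp
  finally show ?case by simp
qed simp

lemma markov_map_Cons:
  assumes "length (a # u) = n"
  shows "markov_map n (\<pi>, M) (a # u) = \<pi> $ a * path_weight (\<lambda>a b. M $ a $ b) a u"
  using assms prod_steps_eq_path_weight[of "\<lambda>a b. M $ a $ b" a u]
  by (simp add: markov_map_def words_def)

text \<open>For fixed \<open>a\<close>, the prefix sums indexed by \<open>v\<close> and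
  \<open>u\<close> factor like an array of rank at most one, which is what makes the 2 x 2
  determinants vanish.\<close>

lemma in_markov_imageD:
  fixes p :: "'a::finite list \<Rightarrow> real"
  assumes "(\<lambda>v\<in>words n. complex_of_real (p v)) \<in> markov_map n ` markov_params"
  obtains c g where
    "\<And>v a u. length (v @ a # u) \<le> n \<Longrightarrow>
       complex_of_real (prefix_sum n p (v @ a # u)) = c (v @ [a]) * g a u"
proof -
  obtain \<pi> M where rows: "\<And>a. (\<Sum>b\<in>UNIV. M $ a $ b) = 1"
    and img: "(\<lambda>v\<in>words n. complex_of_real (p v)) = markov_map n (\<pi>, M)"
    using assms by (auto simp: markov_params_def)
  define m where "m = (\<lambda>a b. M $ a $ b)"
  have m_sum: "(\<Sum>b\<in>UNIV. m a b) = 1" for a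
    by (simp add: m_def rows)
  have p_eq: "complex_of_real (p (a # u)) = \<pi> $ a * path_weight m a u"
    if "length (a # u) = n" for a u
    using that fun_cong[OF img, of "a # u"] markov_map_Cons[OF that, of \<pi> M]
    by (simp add: words_def m_def)
  have prefix: "complex_of_real (prefix_sum n p (b # u)) = \<pi> $ b * path_weight m b u"
    if "length (b # u) \<le> n" for b u
  proof -
    have "complex_of_real (prefix_sum n p (b # u))
        = (\<Sum>w\<in>words (n - length (b # u)). \<pi> $ b * path_weight m b (u @ w))"
      unfolding prefix_sum_def of_real_sum using that
      by (intro sum.cong refl) (simp add: p_eq words_def)
    then show ?thesis
      by (simp add: sum_path_weight_append[OF m_sum] flip: sum_distrib_left)
  qed
  show thesis
  proof
    fix v u :: "'a list" and a
    assume "length (v @ a # u) \<le> n"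
    \<comment> \<open>Here \<open>c\<close> is the initial entry times the weight of the path up to
      \<open>a\<close>; \<open>hd\<close> and \<open>tl\<close> of \<open>v @ [a]\<close> also cover
      empty \<open>v\<close>, where the path starts at \<open>a\<close>.\<close>
    then show "complex_of_real (prefix_sum n p (v @ a # u))
        = (\<pi> $ hd (v @ [a]) * path_weight m (hd (v @ [a])) (tl (v @ [a]))) * path_weight m a u"
    proof (cases v)
      case (Cons b v')
      with \<open>length (v @ a # u) \<le> n\<close> show ?thesis
        using prefix[of b "v' @ a # u"] by (simp add: path_weight_append[of m b v' a u])
    qed (simp add: prefix)
  qed
qed

lemma in_markov_imageI:
  fixes p :: "'a::finite list \<Rightarrow> real"
  assumes "n > 0"
    and rows: "\<And>a. (\<Sum>b\<in>UNIV. m a b) = 1"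
    and step: "\<And>v a b. length (v @ [a, b]) \<le> n \<Longrightarrow>
      prefix_sum n p (v @ [a, b]) = prefix_sum n p (v @ [a]) * m a b"
  shows "(\<lambda>v\<in>words n. complex_of_real (p v)) \<in> markov_map n ` markov_params"
proof
  \<comment> \<open>Since rows sum to 1, every preimage has these one-letter prefix sums as its
    initial vector.\<close>
  define \<pi> where "\<pi> = (\<chi> a. complex_of_real (prefix_sum n p [a]))"
  define M where "M = (\<chi> a b. complex_of_real (m a b))"
  show "(\<pi>, M) \<in> markov_params"
    by (simp add: markov_params_def M_def rows flip: of_real_sum)
  \<comment> \<open>\<open>v\<close> is kept general because the induction on \<open>u\<close> moves
    the letter \<open>a\<close> into it; afterwards the formula is used with \<open>v\<close>
    empty.\<close>
  have path: "prefix_sum n p (v @ a # u) = prefix_sum n p (v @ [a]) * path_weight m a u"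
    if "length (v @ a # u) \<le> n" for v a u
    using that
  proof (induction u arbitrary: v a)
    case (Cons b u)
    then have "prefix_sum n p (v @ a # b # u) = prefix_sum n p (v @ [a, b]) * path_weight m b u"
      using Cons.IH[of "v @ [a]" b] by simp
    then show ?case
      using step[of v a b] Cons.prems by simp
  qed simp
  show "(\<lambda>v\<in>words n. complex_of_real (p v)) = markov_map n (\<pi>, M)"
  proof
    fix v
    show "(\<lambda>v\<in>words n. complex_of_real (p v)) v = markov_map n (\<pi>, M) v"
    proof (cases "length v = n")
      case True
      with \<open>n > 0\<close> obtain a u where v: "v = a # u" by (cases v) auto
      have "p v = prefix_sum n p [a] * path_weight m a u"
        using path[of "[]" a u] prefix_sum_full[of v n p] True v by simp
      then show ?thesis
        using True markov_map_Cons[of a u n \<pi> M]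
        by (simp add: v words_def \<pi>_def M_def path_weight_of_real)
    qed (simp add: words_def markov_map_def)
  qed
qed

text \<open>A single context \<open>w\<close> with nonzero prefix sum at \<open>w @ [a]\<close>
  determines the row of \<open>a\<close>, since \<open>cross\<close> carries its ratios over to
  every other context.\<close>

lemma ex_transition_row:
  fixes p :: "'a::finite list \<Rightarrow> real"
  assumes nonneg: "\<And>v. v \<in> words n \<Longrightarrow> p v \<ge> 0"
    and cross: "\<And>v w b. length (v @ [a, b]) \<le> n \<Longrightarrow> length (w @ [a, b]) \<le> n \<Longrightarrow>
      prefix_sum n p (v @ [a]) * prefix_sum n p (w @ [a, b])
      = prefix_sum n p (w @ [a]) * prefix_sum n p (v @ [a, b])"
  shows "\<exists>r. (\<Sum>b\<in>UNIV. r b) = 1 \<and> (\<forall>v b. length (v @ [a, b]) \<le> n \<longrightarrow>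
    prefix_sum n p (v @ [a, b]) = prefix_sum n p (v @ [a]) * r b)"
\<comment> \<open>The \<open>2\<close> leaves room for a letter after \<open>a\<close>; a word of
  full length ending in \<open>a\<close> puts no condition on the row.\<close>
proof (cases "\<exists>w. length w + 2 \<le> n \<and> prefix_sum n p (w @ [a]) \<noteq> 0")
  case True
  then obtain w where w: "length w + 2 \<le> n" "prefix_sum n p (w @ [a]) \<noteq> 0" by blast
  define r where "r b = prefix_sum n p (w @ [a, b]) / prefix_sum n p (w @ [a])" for b
  have "(\<Sum>b\<in>UNIV. r b) = 1"
    using w prefix_sum_snoc[of "w @ [a]" n p] by (simp add: r_def flip: sum_divide_distrib)
  moreover have "prefix_sum n p (v @ [a, b]) = prefix_sum n p (v @ [a]) * r b"
    if "length (v @ [a, b]) \<le> n" for v b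
    using cross[OF that, of w] w by (simp add: r_def field_simps)
  ultimately show ?thesis by blast
next
  case False
  have "prefix_sum n p (v @ [a, b]) = 0" if "length (v @ [a, b]) \<le> n" for v b
  proof -
    have "(\<Sum>b\<in>UNIV. prefix_sum n p (v @ [a, b])) = 0"
      using False that prefix_sum_snoc[of "v @ [a]" n p] by auto
    moreover have "prefix_sum n p (v @ [a, c]) \<ge> 0" for c
      using that by (intro prefix_sum_nonneg nonneg) auto
    ultimately show ?thesis
      by (simp add: sum_nonneg_eq_0_iff)
  qed
  then show ?thesis
    \<comment> \<open>Both sides of the equation are zero, so any row of sum 1 serves; the unit row
      at \<open>a\<close> is one choice.\<close>
    using False by (intro exI[of _ "\<lambda>b. if b = a then 1 else 0"]) auto
qed

theorem theorem6p2:
  fixes n :: nat and p :: "'a::finite list \<Rightarrow> real"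
  assumes "n \<ge> 2 * CARD('a) - 1"
    and "\<And>v. v \<in> words n \<Longrightarrow> p v \<ge> 0"
  shows "(\<lambda>v\<in>words n. complex_of_real (p v)) \<in> markov_map n ` markov_params \<longleftrightarrow>
    (\<forall>u u' v w a.
       length (v @ a # u) \<le> n \<and> length (v @ a # u') \<le> n \<and>
       length (w @ a # u) \<le> n \<and> length (w @ a # u') \<le> n \<longrightarrow>
       det (vector [vector [prefix_sum n p (v @ a # u), prefix_sum n p (w @ a # u)],
                    vector [prefix_sum n p (v @ a # u'), prefix_sum n p (w @ a # u')]]
            :: real ^ 2 ^ 2) = 0)"
    (is "?image \<longleftrightarrow> ?dets")
proof
  assume ?image
  then obtain c g where factor: "\<And>v a u. length (v @ a # u) \<le> n \<Longrightarrow>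
      complex_of_real (prefix_sum n p (v @ a # u)) = c (v @ [a]) * g a u"
    using in_markov_imageD by blast
  show ?dets
  proof (intro allI impI, elim conjE)
    fix u u' v w :: "'a list" and a
    assume le: "length (v @ a # u) \<le> n" "length (v @ a # u') \<le> n"
      "length (w @ a # u) \<le> n" "length (w @ a # u') \<le> n"
    \<comment> \<open>Each side is the product of \<open>c (v @ [a])\<close>,
      \<open>c (w @ [a])\<close>, \<open>g a u\<close> and \<open>g a u'\<close>. These are complex,
      so the identity is proved there and pulled back along the injective embedding of the
      reals.\<close>
    have "complex_of_real (prefix_sum n p (v @ a # u) * prefix_sum n p (w @ a # u'))
        = complex_of_real (prefix_sum n p (w @ a # u) * prefix_sum n p (v @ a # u'))"
      unfolding of_real_mult factor[OF le(1)] factor[OF le(2)] factor[OF le(3)] factor[OF le(4)]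
      by simp
    then show "det (vector [vector [prefix_sum n p (v @ a # u), prefix_sum n p (w @ a # u)],
                    vector [prefix_sum n p (v @ a # u'), prefix_sum n p (w @ a # u')]]
            :: real ^ 2 ^ 2) = 0"
      unfolding of_real_eq_iff by (simp add: det_2)
  qed
next
  assume dets: ?dets
  \<comment> \<open>A type has at least one element, so the bound on \<open>n\<close> gives
    \<open>n \<ge> 1\<close>, and every word has a first letter to carry the factor from
    \<pi>.\<close>
  have "n > 0"
    using assms(1) zero_less_card_finite[where 'a = 'a] by linarith
  have cross: "prefix_sum n p (v @ [a]) * prefix_sum n p (w @ [a, b])
      = prefix_sum n p (w @ [a]) * prefix_sum n p (v @ [a, b])"
    if "length (v @ [a, b]) \<le> n" "length (w @ [a, b]) \<le> n" for v w :: "'a list" and a b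
    using dets[rule_format, of v a "[]" "[b]" w] that by (simp add: det_2)
  have "\<forall>a. \<exists>r :: 'a \<Rightarrow> real. (\<Sum>b\<in>UNIV. r b) = 1 \<and> (\<forall>v b. length (v @ [a, b]) \<le> n \<longrightarrow>
      prefix_sum n p (v @ [a, b]) = prefix_sum n p (v @ [a]) * r b)"
    using ex_transition_row[OF assms(2) cross] by blast
  then obtain m where "\<And>a. (\<Sum>b\<in>UNIV. m a b) = 1"
    and "\<And>v a b. length (v @ [a, b]) \<le> n \<Longrightarrow>
      prefix_sum n p (v @ [a, b]) = prefix_sum n p (v @ [a]) * m a b"
    by metis
  with \<open>n > 0\<close> show ?image
    by (rule in_markov_imageI)
qed

end
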